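(* Let $A\in\mathbb{R}^{n\times n}$, $C=I\in\mathbb{R}^{n\times n}$, $N\ge1$, let $L=W_o$ be the observability Gramian over horizon $N$, $K=L(L+I)^{-1}$, and let $Y\sim\mathcal{P}_L$ be a random subset of $\mathcal{Y}=\{1,\dots,n\}$. For any two disjoint sensor configurations $S_1,S_2\subseteq\mathcal{Y}$, the joint inclusion probability satisfies $$\mathbb{P}(S_1\cup S_2\subseteq Y)\le\mathbb{P}(S_1\subseteq Y)\cdot\mathbb{P}(S_2\subseteq Y).$$ In particular, for any two nodes $i\ne j$, $$\mathbb{P}(i,j\in Y)=K_{ii}K_{jj}-K_{ij}^2\le\mathbb{P}(i\in Y)\cdot\mathbb{P}(j\in Y),$$ where the gap $K_{ij}^2$ increases with the observability correlation between nodes $i$ and $j$.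
   Context: For the discrete-time linear system $x[k+1]=Ax[k]+Bu[k]$, $y[k]=Cx[k]$, the observability Gramian over horizon $N$ is $W_o=\sum_{k=0}^{N-1}(A^k)^\top C^\top CA^k=O^\top O\in\mathbb{R}^{n\times n}$, where $O=[C^\top,(CA)^\top,\dots,(CA^{N-1})^\top]^\top$ is the observability matrix. With $C=I$ every state variable is a candidate sensor node. The entry $(W_o)_{ij}=o_i^\top o_j$ is the inner product of the columns $o_i,o_j$ of $O$ associated with nodes $i$ and $j$; the term "observability correlation between nodes $i$ and $j$" is used informally, for the degree to which these observability directions overlap. For a matrix $M$ and an index set $S$, $M_S=[M_{ij}]_{i,j\in S}$ is the principal submatrix, with $\det(M_\emptyset)=1$. For symmetric $L\succeq0$ indexed by $\mathcal{Y}$, the L-ensemble determinantal point process is the probability measure $\mathcal{P}_L(Y)=\det(L_Y)/\det(L+I)$ on $2^{\mathcal{Y}}$, and $K=L(L+I)^{-1}$ is its marginal kernel, for which $\mathbb{P}(S\subseteq Y)=\det(K_S)$ for all $S\subseteq\mathcal{Y}$.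
   Formalization: The gap clause fails for |o_i·o_j| in general; with other Gramian entries fixed, K_ij strictly increases with o_i·o_j, and K_ij² grows if o_i·o_j moves in the direction of the sign of K_ij, or with |o_i·o_j| if no third node overlaps with i. *)

theory Defs
  imports "HOL-Probability.Probability"
begin

(* "^" on square matrices is the componentwise power, hence this recursion. *)
primrec mat_pow :: "'a::semiring_1^'n^'n \<Rightarrow> nat \<Rightarrow> 'a^'n^'n" where
  "mat_pow A 0 = mat 1"
| "mat_pow A (Suc k) = A ** mat_pow A k"

definition obs_gramian :: "real^'n^'p \<Rightarrow> real^'n^'n \<Rightarrow> nat \<Rightarrow> real^'n^'n" where
  "obs_gramian C A N =
     (\<Sum>k<N. transpose (mat_pow A k) ** transpose C ** C ** mat_pow A k)"

(* The observability matrix stacks the N blocks C A^k, so its rows are indexed by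
   pairs (k, p) with k < N. *)
definition obs_matrix :: "real^'n^'p \<Rightarrow> real^'n^'n \<Rightarrow> nat \<times> 'p \<Rightarrow> 'n \<Rightarrow> real" where
  "obs_matrix C A = (\<lambda>(k, p) i. (C ** mat_pow A k) $ p $ i)"

lemma obs_gramian_eq_inner_columns:
  "obs_gramian C A N $ i $ j =
     (\<Sum>r\<in>{..<N} \<times> UNIV. obs_matrix C A r i * obs_matrix C A r j)"
proof -
  have "(transpose (mat_pow A k) ** transpose C ** C ** mat_pow A k) $ i $ j
      = (\<Sum>p\<in>UNIV. (C ** mat_pow A k) $ p $ i * (C ** mat_pow A k) $ p $ j)" for k
  proof -
    have "transpose (mat_pow A k) ** transpose C ** C ** mat_pow A k
        = transpose (C ** mat_pow A k) ** (C ** mat_pow A k)"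
      by (simp add: matrix_transpose_mul matrix_mul_assoc)
    then show ?thesis
      by (simp add: matrix_matrix_mult_def transpose_def)
  qed
  then show ?thesis
    by (simp add: obs_gramian_def obs_matrix_def sum.cartesian_product case_prod_unfold)
qed

(* The determinant of the principal submatrix with index set S: the Leibniz formula of
   det_def, with S in place of the whole index type. *)
definition principal_minor :: "'a::comm_ring_1^'n^'n \<Rightarrow> 'n set \<Rightarrow> 'a" where
  "principal_minor M S =
     (\<Sum>p | p permutes S. of_int (sign p) * (\<Prod>i\<in>S. M $ i $ p i))"

lemma principal_minor_empty: "principal_minor M {} = 1"
  by (simp add: principal_minor_def)

lemma principal_minor_UNIV: "principal_minor M UNIV = det M"
  by (simp add: principal_minor_def det_def)

lemma principal_minor_eq_det:
  fixes M :: "'a::comm_ring_1^'n^'n" and f :: "'m::finite \<Rightarrow> 'n"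
  assumes "inj f"
  shows "principal_minor M (range f) = det (\<chi> a b. M $ f a $ f b)"
proof -
  let ?P = "{p. p permutes (UNIV :: 'm set)}"
  let ?h = "map_permutation UNIV f"
  have bij: "bij_betw f UNIV (range f)"
    using assms by (simp add: bij_betw_def)
  have h_apply: "?h p (f a) = f (p a)" for p a
    using assms by (simp add: map_permutation_apply)
  have perm: "?h p permutes range f" if "p permutes UNIV" for p
    using bij that by (rule map_permutation_permutes)
  have "bij_betw ?h ?P {q. q permutes range f}"
  proof (rule bij_betw_imageI)
    show "inj_on ?h ?P"
      using assms h_apply by (intro inj_onI ext) (metis injD)
    show "?h ` ?P = {q. q permutes range f}"
    proof (intro equalityI subsetI)
      fix q assume "q \<in> {q. q permutes range f}"
      then have q: "q permutes range f" by simp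
      define p where "p = (\<lambda>a. inv f (q (f a)))"
      have fp: "f (p a) = q (f a)" for a
        using permutes_in_image [OF q] by (simp add: p_def f_inv_into_f)
      have "inj p"
        using assms permutes_inj [OF q] by (metis fp injD injI)
      then have p: "p permutes UNIV"
        by (intro bij_imp_permutes) (simp_all add: finite_UNIV_inj_surj bij_def)
      have "?h p x = q x" for x
        using perm [OF p] q h_apply fp by (cases "x \<in> range f") (auto simp: permutes_not_in)
      then show "q \<in> ?h ` ?P"
        using p by (metis ext image_eqI mem_Collect_eq)
    qed (use perm in auto)
  qed
  then have "principal_minor M (range f) =
      (\<Sum>p\<in>?P. of_int (sign (?h p)) * (\<Prod>i\<in>range f. M $ i $ ?h p i))"
    unfolding principal_minor_def by (rule sum.reindex_bij_betw [symmetric])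
  also have "\<dots> = det (\<chi> a b. M $ f a $ f b)"
    unfolding det_def
    using assms by (intro sum.cong) (simp_all add: sign_map_permutation prod.reindex h_apply)
  finally show ?thesis .
qed

definition L_ensemble :: "real^'n^'n \<Rightarrow> 'n set measure" where
  "L_ensemble L =
     point_measure UNIV (\<lambda>T. ennreal (principal_minor L T / det (L + mat 1)))"

definition marginal_kernel :: "real^'n^'n \<Rightarrow> real^'n^'n" where
  "marginal_kernel L = L ** matrix_inv (L + mat 1)"

end

theory Submission
  imports Defs
begin

text \<open>
  Put \<open>P = L + I\<close> and \<open>G = P\<inverse>\<close>, so that \<open>K = I - G = L G\<close>. Expanding \<open>det\<close> row by row,
  \<open>\<Sum>T\<supseteq>S. det L\<^sub>T\<close> is the determinant of the matrix with rows of \<open>L = K P\<close> on \<open>S\<close> and rows of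
  \<open>P\<close> off \<open>S\<close>, which is \<open>det K\<^sub>S * det P\<close>; hence \<open>\<P>(S \<subseteq> Y) = det K\<^sub>S\<close>, and negative
  association is Fischer's inequality for the positive semidefinite matrix \<open>K\<close>.
  When \<open>L\<close> and \<open>L'\<close> differ only in the entries \<open>(i, j)\<close> and \<open>(j, i)\<close>, the resolvent identity
  \<open>G - G' = G' (L' - L) G\<close> gives
  \<open>K'\<^sub>i\<^sub>j - K\<^sub>i\<^sub>j = (L'\<^sub>i\<^sub>j - L\<^sub>i\<^sub>j) (G'\<^sub>i\<^sub>i G\<^sub>j\<^sub>j + G'\<^sub>i\<^sub>j G\<^sub>i\<^sub>j)\<close>. Its transpose
  shows \<open>G'\<^sub>i\<^sub>i G\<^sub>j\<^sub>j = G'\<^sub>j\<^sub>j G\<^sub>i\<^sub>i\<close>, so positivity of the \<open>2 \<times> 2\<close> minors of \<open>G\<close> and \<open>G'\<close>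
  makes the last factor positive. If node \<open>i\<close> is coupled to \<open>j\<close> only, row \<open>i\<close> of \<open>P G = I\<close> reads
  \<open>K\<^sub>i\<^sub>j = L\<^sub>i\<^sub>j G\<^sub>j\<^sub>j / P\<^sub>i\<^sub>i\<close>, and \<open>G\<^sub>j\<^sub>j\<close> grows with \<open>\<bar>L\<^sub>i\<^sub>j\<bar>\<close>.
\<close>

section \<open>Principal minors\<close>

text \<open>After reordering the indices this is block triangular with diagonal blocks
  \<open>M\<^sub>S\<close> and the identity, so principal minors become full determinants and the
  theory of \<open>det\<close> and \<open>invertible\<close> applies to them.\<close>

definition fill_rows :: "'a::comm_ring_1^'n^'n \<Rightarrow> 'n set \<Rightarrow> 'a^'n^'n" where
  "fill_rows M S = (\<chi> i. if i \<in> S then M $ i else axis i 1)"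

lemma fill_rows_nth: "fill_rows M S $ i $ j = (if i \<in> S then M $ i $ j else if i = j then 1 else 0)"
  by (simp add: fill_rows_def axis_def)

lemma fill_rows_mult_nth:
  "(fill_rows M S *v x) $ i = (if i \<in> S then (M *v x) $ i else x $ i)"
  by (simp add: matrix_vector_mult_def fill_rows_nth mult_delta_left)

text \<open>In the Leibniz sum a permutation that moves a point outside \<open>S\<close> meets an
  off-diagonal zero of a unit row; the others permute \<open>S\<close> and only pick up factors 1
  outside it.\<close>

lemma det_fill_rows: "det (fill_rows M S) = principal_minor M S"
proof -
  have "det (fill_rows M S) =
      (\<Sum>p | p permutes S. of_int (sign p) * (\<Prod>i\<in>UNIV. fill_rows M S $ i $ p i))"
    unfolding det_def
  proof (rule sum.mono_neutral_right)
    show "{p. p permutes S} \<subseteq> {p. p permutes UNIV}"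
      using permutes_subset by blast
    show "\<forall>p\<in>{p. p permutes UNIV} - {p. p permutes S}.
        of_int (sign p) * (\<Prod>i\<in>UNIV. fill_rows M S $ i $ p i) = 0"
    proof
      fix p assume p: "p \<in> {p. p permutes UNIV} - {p. p permutes S}"
      then obtain i where "i \<notin> S" "p i \<noteq> i"
        by (auto simp: permutes_def)
      then have "fill_rows M S $ i $ p i = 0"
        by (auto simp: fill_rows_nth)
      then have "(\<Prod>i\<in>UNIV. fill_rows M S $ i $ p i) = 0"
        by (intro prod_zero) auto
      then show "of_int (sign p) * (\<Prod>i\<in>UNIV. fill_rows M S $ i $ p i) = 0"
        by simp
    qed
  qed simp
  also have "\<dots> = principal_minor M S"
    unfolding principal_minor_def
  proof (intro sum.cong refl arg_cong2 [where f = "(*)"])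
    fix p assume "p \<in> {p. p permutes S}"
    then have "(\<Prod>i\<in>UNIV. fill_rows M S $ i $ p i) = (\<Prod>i\<in>S. fill_rows M S $ i $ p i)"
      by (intro prod.mono_neutral_right) (auto simp: fill_rows_nth permutes_not_in)
    then show "(\<Prod>i\<in>UNIV. fill_rows M S $ i $ p i) = (\<Prod>i\<in>S. M $ i $ p i)"
      by (simp add: fill_rows_nth)
  qed
  finally show ?thesis .
qed

lemma principal_minor_singleton: "principal_minor M {i} = M $ i $ i"
proof -
  have "{p. p permutes {i}} = {id}"
    by (auto simp: permutes_sing)
  then show ?thesis
    by (simp add: principal_minor_def)
qed

lemma principal_minor_doubleton:
  assumes "i \<noteq> j"
  shows "principal_minor M {i, j} = M $ i $ i * M $ j $ j - M $ i $ j * M $ j $ i"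
proof -
  define f :: "2 \<Rightarrow> _" where "f a = (if a = 1 then i else j)" for a
  have range: "range f = {i, j}"
    using exhaust_2 by (auto simp: f_def UNIV_2)
  have "inj f"
    using assms exhaust_2 by (auto simp: f_def inj_on_def split: if_splits)
  from principal_minor_eq_det [OF this, of M] show ?thesis
    unfolding range by (simp add: det_2 f_def)
qed

text \<open>Multilinearity: \<open>T\<close> collects the rows that choose the summand
  \<open>a\<close>. The induction needs \<open>c\<close> arbitrary, since a row already expanded is
  stored in \<open>c\<close>.\<close>

lemma det_add_rows_on:
  fixes a b c :: "'n::finite \<Rightarrow> 'a::comm_ring_1^'n"
  assumes "finite S"
  shows "det (\<chi> i. if i \<in> S then a i + b i else c i) =
    (\<Sum>T\<in>Pow S. det (\<chi> i. if i \<in> T then a i else if i \<in> S then b i else c i))"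
  using assms
proof (induction S arbitrary: c rule: finite_induct)
  case empty
  then show ?case by simp
next
  case (insert k S)
  let ?m = "\<lambda>T. det (\<chi> i. if i \<in> T then a i else if i \<in> insert k S then b i else c i)"
  have split: "det (\<chi> i. if i \<in> insert k S then a i + b i else c i) =
      det (\<chi> i. if i \<in> S then a i + b i else (c(k := a k)) i) +
      det (\<chi> i. if i \<in> S then a i + b i else (c(k := b k)) i)"
  proof -
    have "det (\<chi> i. if i = k then a i + b i else if i \<in> S then a i + b i else c i) =
      det (\<chi> i. if i = k then a i else if i \<in> S then a i + b i else c i) +
      det (\<chi> i. if i = k then b i else if i \<in> S then a i + b i else c i)"
      by (rule det_row_add)
    moreover have "(\<lambda>i. if i = k then d i else if i \<in> S then a i + b i else c i) =
        (\<lambda>i. if i \<in> S then a i + b i else (c(k := d k)) i)" for d :: "'n \<Rightarrow> 'a^'n"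
      using insert.hyps by auto
    moreover have "(\<lambda>i. if i = k then a i + b i else if i \<in> S then a i + b i else c i) =
        (\<lambda>i. if i \<in> insert k S then a i + b i else c i)"
      by auto
    ultimately show ?thesis
      by simp
  qed
  \<comment> \<open>Subsets are split by whether they contain \<open>k\<close>, matching the two
    determinants of \<open>split\<close>.\<close>
  have "(\<Sum>T\<in>Pow (insert k S). ?m T) = (\<Sum>T\<in>insert k ` Pow S. ?m T) + (\<Sum>T\<in>Pow S. ?m T)"
    using insert.hyps by (subst add.commute, subst Pow_insert, subst sum.union_disjoint) auto
  also have "(\<Sum>T\<in>insert k ` Pow S. ?m T) = (\<Sum>T\<in>Pow S. ?m (insert k T))"
    using insert.hyps by (subst sum.reindex) (auto simp: inj_on_def insert_ident)
  also have "\<dots> = det (\<chi> i. if i \<in> S then a i + b i else (c(k := a k)) i)"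
    unfolding insert.IH using insert.hyps
    by (intro sum.cong arg_cong [where f = det]) (auto simp: vec_eq_iff)
  also have "(\<Sum>T\<in>Pow S. ?m T) = det (\<chi> i. if i \<in> S then a i + b i else (c(k := b k)) i)"
    unfolding insert.IH using insert.hyps
    by (intro sum.cong arg_cong [where f = det]) (auto simp: vec_eq_iff)
  finally show ?case
    using split by simp
qed

text \<open>For \<open>T \<supseteq> S\<close>, each row outside \<open>S\<close> is either a row of
  \<open>M\<close> or a unit row; summing over these choices adds the two. The case
  \<open>S = {}\<close> is the normalisation of the L-ensemble.\<close>

lemma sum_principal_minors_superset:
  fixes M :: "'a::comm_ring_1^'n^'n"
  shows "(\<Sum>T | S \<subseteq> T. principal_minor M T) =
    det (\<chi> i. if i \<in> S then M $ i else (M + mat 1) $ i)"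
proof -
  have "(\<Sum>T | S \<subseteq> T. principal_minor M T) = (\<Sum>T\<in>Pow (- S). principal_minor M (S \<union> T))"
    by (rule sum.reindex_bij_witness [where i = "\<lambda>T. S \<union> T" and j = "\<lambda>T. T - S"])
      (auto simp: Un_absorb1)
  also have "\<dots> = (\<Sum>T\<in>Pow (- S).
      det (\<chi> i. if i \<in> T then M $ i else if i \<in> - S then axis i 1 else M $ i))"
    unfolding det_fill_rows [symmetric] fill_rows_def
    by (intro sum.cong arg_cong [where f = det]) (auto simp: vec_eq_iff)
  also have "\<dots> = det (\<chi> i. if i \<in> - S then M $ i + axis i 1 else M $ i)"
    by (rule det_add_rows_on [symmetric]) simp
  also have "(\<chi> i. if i \<in> - S then M $ i + axis i 1 else M $ i) =
      (\<chi> i. if i \<in> S then M $ i else (M + mat 1) $ i)"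
    by (auto simp: vec_eq_iff mat_def axis_def)
  finally show ?thesis .
qed

section \<open>Positive semidefinite matrices and Fischer's inequality\<close>

definition pos_semidef :: "real^'n^'n \<Rightarrow> bool" where
  "pos_semidef M \<longleftrightarrow> transpose M = M \<and> (\<forall>x. 0 \<le> x \<bullet> (M *v x))"

lemma symmetric_inner_commute:
  fixes M :: "real^'n^'n"
  assumes "transpose M = M"
  shows "x \<bullet> (M *v y) = y \<bullet> (M *v x)"
  using assms by (metis dot_lmul_matrix inner_commute transpose_matrix_vector)

text \<open>Otherwise a small step from \<open>x\<close> in the direction \<open>- (M *v x)\<close>
  would make the quadratic form negative.\<close>

lemma pos_semidef_null:
  assumes "pos_semidef M" "x \<bullet> (M *v x) = 0"
  shows "M *v x = 0"
proof (rule ccontr)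
  assume nz: "M *v x \<noteq> 0"
  define y where "y = M *v x"
  define c where "c = y \<bullet> (M *v y)"
  have sym: "transpose M = M" and nn: "\<And>z. 0 \<le> z \<bullet> (M *v z)"
    using assms by (auto simp: pos_semidef_def)
  have y: "y \<bullet> y > 0" "x \<bullet> (M *v y) = y \<bullet> y"
    using nz symmetric_inner_commute [OF sym, of x y] by (simp_all add: y_def)
  have c: "c \<ge> 0"
    by (simp add: c_def nn)
  have q: "0 \<le> c * t\<^sup>2 - 2 * t * (y \<bullet> y)" for t
  proof -
    have "(x - t *\<^sub>R y) \<bullet> (M *v (x - t *\<^sub>R y)) = c * t\<^sup>2 - 2 * t * (y \<bullet> y)"
      using assms(2) y(2) c_def
      by (simp add: matrix_vector_mult_diff_distrib matrix_vector_mult_scaleR inner_diff_left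
          inner_diff_right y_def [symmetric] power2_eq_square algebra_simps)
    then show ?thesis
      using nn by metis
  qed
  \<comment> \<open>The summand 1 covers \<open>c = 0\<close>; this step makes the quadratic term at
    most half of the linear one.\<close>
  define t where "t = y \<bullet> y / (c + 1)"
  have "t > 0" and ct: "c * t \<le> y \<bullet> y"
    using y c by (auto simp: t_def field_simps)
  then have "c * t\<^sup>2 - 2 * t * (y \<bullet> y) \<le> - (t * (y \<bullet> y))"
    using mult_left_mono [OF ct, of t] by (simp add: power2_eq_square algebra_simps)
  moreover have "t * (y \<bullet> y) > 0"
    using \<open>t > 0\<close> y by simp
  ultimately show False
    using q [of t] by linarith
qed

text \<open>A kernel vector of \<open>M\<^sub>S\<close>, extended by zero, has vanishing quadratic
  form, so \<open>M\<close> kills it and \<open>M\<^sub>T\<close> is singular too. This settles the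
  degenerate cases, where no Schur complement is available.\<close>

lemma principal_minor_eq_0_mono:
  assumes "pos_semidef M" "S \<subseteq> T" "principal_minor M S = 0"
  shows "principal_minor M T = 0"
proof -
  obtain x where x: "x \<noteq> 0" "fill_rows M S *v x = 0"
    using assms(3) invertible_det_nz [of "fill_rows M S"]
      matrix_left_invertible_ker [of "fill_rows M S"] invertible_left_inverse
    by (auto simp: det_fill_rows)
  have on: "(M *v x) $ i = 0" if "i \<in> S" for i
    using arg_cong [OF x(2), of "\<lambda>v. v $ i"] that by (simp add: fill_rows_mult_nth)
  have off: "x $ i = 0" if "i \<notin> S" for i
    using arg_cong [OF x(2), of "\<lambda>v. v $ i"] that by (simp add: fill_rows_mult_nth)
  have "x \<bullet> (M *v x) = 0"
    unfolding inner_vec_def using on off by (intro sum.neutral) (metis inner_zero_left inner_zero_right)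
  with assms(1) have "M *v x = 0"
    by (rule pos_semidef_null)
  then have "fill_rows M T *v x = 0"
    using off assms(2) by (auto simp: vec_eq_iff fill_rows_mult_nth)
  then have "\<not> invertible (fill_rows M T)"
    using x(1) matrix_left_invertible_ker [of "fill_rows M T"] invertible_left_inverse by blast
  then show ?thesis
    by (simp add: invertible_det_nz det_fill_rows)
qed

text \<open>The factor \<open>v \<bullet> (M *v v)\<close> is a Schur complement; its description as a minimum makes it
  antitone in \<open>S\<close>, which is all that Fischer's inequality needs.\<close>
lemma principal_minor_insert:
  fixes M :: "real^'n^'n"
  assumes M: "pos_semidef M" and i: "i \<notin> S" and nz: "principal_minor M S \<noteq> 0"
  obtains v where "v $ i = 1" "\<forall>j. j \<notin> insert i S \<longrightarrow> v $ j = 0"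
    "principal_minor M (insert i S) = (v \<bullet> (M *v v)) * principal_minor M S"
    "\<forall>w. w $ i = 1 \<and> (\<forall>j. j \<notin> insert i S \<longrightarrow> w $ j = 0) \<longrightarrow> v \<bullet> (M *v v) \<le> w \<bullet> (M *v w)"
proof -
  have sym: "transpose M = M" and nn: "\<And>z. 0 \<le> z \<bullet> (M *v z)"
    using M by (auto simp: pos_semidef_def)
  have "invertible (fill_rows M S)"
    using nz by (simp add: invertible_det_nz det_fill_rows)
  \<comment> \<open>Here \<open>x\<close> is supported in \<open>S\<close>, and
    \<open>M *v x\<close> matches column \<open>i\<close> of \<open>M\<close> there, so
    \<open>M *v v\<close> vanishes on \<open>S\<close>.\<close>
  then obtain x where x: "fill_rows M S *v x = (\<chi> j. if j \<in> S then (M *v axis i 1) $ j else 0)"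
    by (metis invertible_right_inverse matrix_right_invertible_surjective surjD)
  define v where "v = axis i 1 - x"
  have x_on: "(M *v x) $ j = (M *v axis i 1) $ j" if "j \<in> S" for j
    using arg_cong [OF x, of "\<lambda>v. v $ j"] that by (simp add: fill_rows_mult_nth)
  have x_off: "x $ j = 0" if "j \<notin> S" for j
    using arg_cong [OF x, of "\<lambda>v. v $ j"] that by (simp add: fill_rows_mult_nth)
  have Mv: "(M *v v) $ j = 0" if "j \<in> S" for j
    using x_on [OF that] by (simp add: v_def matrix_vector_mult_diff_distrib)
  have vi: "v $ i = 1"
    using x_off i by (simp add: v_def)
  have v_off: "v $ j = 0" if "j \<notin> insert i S" for j
    using x_off that by (auto simp: v_def axis_def)
  have orth: "d \<bullet> (M *v v) = 0" if "\<And>j. j \<notin> S \<Longrightarrow> d $ j = 0" for d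
    unfolding inner_vec_def using that Mv
    by (intro sum.neutral) (metis inner_zero_left inner_zero_right)
  have vMv: "v \<bullet> (M *v v) = (M *v v) $ i"
    using orth [of x] x_off by (simp add: v_def inner_diff_left inner_axis')
  \<comment> \<open>By Cramer's lemma, column \<open>i\<close> may be replaced by the image of
    \<open>v\<close> because \<open>v $ i = 1\<close>; that image is
    \<open>v \<bullet> (M *v v)\<close> times a unit vector.\<close>
  have "principal_minor M (insert i S) = v $ i * det (fill_rows M (insert i S))"
    by (simp add: vi det_fill_rows)
  also have "\<dots> = det (\<chi> k l. if l = i then (fill_rows M (insert i S) *v v) $ k
      else fill_rows M (insert i S) $ k $ l)"
    by (rule cramer_lemma [symmetric])
  also have "\<dots> = (v \<bullet> (M *v v)) * det (fill_rows M S)"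
    unfolding det_def sum_distrib_left
  proof (intro sum.cong refl)
    fix p :: "'n \<Rightarrow> 'n" assume "p \<in> {p. p permutes UNIV}"
    then have p: "p permutes UNIV"
      by simp
    let ?X = "(\<chi> k l. if l = i then (fill_rows M (insert i S) *v v) $ k
      else fill_rows M (insert i S) $ k $ l)"
    have X: "?X $ k $ i = (if k = i then v \<bullet> (M *v v) else 0)" for k
      using Mv v_off vMv by (auto simp: fill_rows_mult_nth)
    \<comment> \<open>Only permutations fixing \<open>i\<close> contribute: on the left column
      \<open>i\<close> is a multiple of a unit vector, on the right row \<open>i\<close> is a unit
      row.\<close>
    have prod_eq: "(\<Prod>k\<in>UNIV. ?X $ k $ p k) = (v \<bullet> (M *v v)) * (\<Prod>k\<in>UNIV. fill_rows M S $ k $ p k)"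
    proof (cases "p i = i")
      case True
      have "(\<Prod>k\<in>UNIV - {i}. ?X $ k $ p k) = (\<Prod>k\<in>UNIV - {i}. fill_rows M S $ k $ p k)"
      proof (rule prod.cong [OF refl])
        fix k assume "k \<in> UNIV - {i}"
        moreover from this have "p k \<noteq> i"
          using True permutes_inj [OF p] by (metis DiffD2 injD singletonI)
        ultimately show "?X $ k $ p k = fill_rows M S $ k $ p k"
          by (simp add: fill_rows_nth)
      qed
      moreover have "?X $ i $ p i = v \<bullet> (M *v v)" "fill_rows M S $ i $ p i = 1"
        using True X i by (simp_all add: fill_rows_nth)
      ultimately show ?thesis
        by (subst (1 2) prod.remove [of _ i]) simp_all
    next
      case False
      obtain k where k: "p k = i"
        using permutes_surj [OF p] by (metis surjD)
      with False have "?X $ k $ p k = 0"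
        using X by auto
      then have X0: "(\<Prod>k\<in>UNIV. ?X $ k $ p k) = 0"
        by (intro prod_zero bexI [of _ k]) simp_all
      have "fill_rows M S $ i $ p i = 0"
        using False i by (simp add: fill_rows_nth)
      then have "(\<Prod>k\<in>UNIV. fill_rows M S $ k $ p k) = 0"
        by (intro prod_zero) auto
      then show ?thesis
        unfolding X0 by simp
    qed
    show "of_int (sign p) * (\<Prod>k\<in>UNIV. ?X $ k $ p k) =
        (v \<bullet> (M *v v)) * (of_int (sign p) * (\<Prod>k\<in>UNIV. fill_rows M S $ k $ p k))"
      unfolding prod_eq by (rule mult.left_commute)
  qed
  finally have minor: "principal_minor M (insert i S) = (v \<bullet> (M *v v)) * principal_minor M S"
    by (simp add: det_fill_rows)
  have "v \<bullet> (M *v v) \<le> w \<bullet> (M *v w)"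
    if w: "w $ i = 1" "\<And>j. j \<notin> insert i S \<Longrightarrow> w $ j = 0" for w
  proof -
    \<comment> \<open>The difference is supported in \<open>S\<close>, hence
      \<open>M\<close>-orthogonal to \<open>v\<close>, and Pythagoras gives minimality.\<close>
    define d where "d = w - v"
    have "d $ j = 0" if "j \<notin> S" for j
      using w vi v_off that by (cases "j = i") (auto simp: d_def)
    then have "d \<bullet> (M *v v) = 0"
      by (rule orth)
    moreover have "v \<bullet> (M *v d) = d \<bullet> (M *v v)"
      by (rule symmetric_inner_commute [OF sym])
    moreover have "w = v + d"
      by (simp add: d_def)
    ultimately have "w \<bullet> (M *v w) = v \<bullet> (M *v v) + d \<bullet> (M *v d)"
      by (simp add: matrix_vector_right_distrib inner_add_left inner_add_right)
    then show ?thesis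
      using nn [of d] by simp
  qed
  then have "\<forall>w. w $ i = 1 \<and> (\<forall>j. j \<notin> insert i S \<longrightarrow> w $ j = 0) \<longrightarrow> v \<bullet> (M *v v) \<le> w \<bullet> (M *v w)"
    by blast
  moreover have "\<forall>j. j \<notin> insert i S \<longrightarrow> v $ j = 0"
    using v_off by blast
  ultimately show thesis
    using vi minor that by blast
qed

lemma principal_minor_nonneg:
  assumes "pos_semidef M"
  shows "0 \<le> principal_minor M S"
proof -
  have "finite S" by simp
  then show ?thesis
  proof (induction S rule: finite_induct)
    case empty
    then show ?case by (simp add: principal_minor_empty)
  next
    case (insert i S)
    show ?case
    proof (cases "principal_minor M S = 0")
      case True
      then show ?thesis
        using principal_minor_eq_0_mono [OF assms, of S "insert i S"] True by (simp add: subset_insertI)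
    next
      case False
      obtain v where "principal_minor M (insert i S) = (v \<bullet> (M *v v)) * principal_minor M S"
        by (rule principal_minor_insert [OF assms insert.hyps(2) False])
      moreover have "0 \<le> v \<bullet> (M *v v)"
        using assms by (simp add: pos_semidef_def)
      ultimately show ?thesis
        using insert.IH by simp
    qed
  qed
qed

text \<open>Adding \<open>i\<close> to \<open>T\<close> multiplies each side by a Schur complement.
  The one relative to \<open>S \<union> T\<close> is a minimum over a larger set of vectors than the
  one relative to \<open>T\<close>, so it is no larger.\<close>

lemma Fischer_inequality:
  assumes M: "pos_semidef M" and disj: "S \<inter> T = {}"
  shows "principal_minor M (S \<union> T) \<le> principal_minor M S * principal_minor M T"
proof -
  have "finite T" by simp
  then show ?thesis
    using disj
  proof (induction T rule: finite_induct)
    case empty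
    then show ?case by (simp add: principal_minor_empty)
  next
    case (insert i T)
    show ?case
    proof (cases "principal_minor M (S \<union> T) = 0")
      case True
      then have "principal_minor M (S \<union> insert i T) = 0"
        using principal_minor_eq_0_mono [OF M, of "S \<union> T" "S \<union> insert i T"] by auto
      then show ?thesis
        using principal_minor_nonneg [OF M] by simp
    next
      case False
      then have T0: "principal_minor M T \<noteq> 0"
        using principal_minor_eq_0_mono [OF M, of T "S \<union> T"] by auto
      have iST: "i \<notin> S \<union> T"
        using insert by auto
      obtain v where v: "principal_minor M (insert i (S \<union> T)) = (v \<bullet> (M *v v)) * principal_minor M (S \<union> T)"
        "\<forall>w. w $ i = 1 \<and> (\<forall>j. j \<notin> insert i (S \<union> T) \<longrightarrow> w $ j = 0) \<longrightarrow> v \<bullet> (M *v v) \<le> w \<bullet> (M *v w)"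
        by (rule principal_minor_insert [OF M iST False])
      obtain w where w: "w $ i = 1" "\<forall>j. j \<notin> insert i T \<longrightarrow> w $ j = 0"
        "principal_minor M (insert i T) = (w \<bullet> (M *v w)) * principal_minor M T"
        by (rule principal_minor_insert [OF M insert.hyps(2) T0])
      have le: "v \<bullet> (M *v v) \<le> w \<bullet> (M *v w)"
        using w by (intro v(2) [rule_format]) auto
      have IH: "principal_minor M (S \<union> T) \<le> principal_minor M S * principal_minor M T"
        using insert.prems by (intro insert.IH) simp
      have "principal_minor M (S \<union> insert i T) = (v \<bullet> (M *v v)) * principal_minor M (S \<union> T)"
        using v(1) by (simp only: Un_insert_right)
      also have "\<dots> \<le> (w \<bullet> (M *v w)) * (principal_minor M S * principal_minor M T)"
        using M by (intro mult_mono le IH mult_nonneg_nonneg principal_minor_nonneg) (simp_all add: pos_semidef_def)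
      also have "\<dots> = principal_minor M S * principal_minor M (insert i T)"
        unfolding w(3) by (rule mult.left_commute)
      finally show ?thesis .
    qed
  qed
qed

section \<open>The marginal kernel of an L-ensemble\<close>

lemma matrix_mult_add_rdistrib: "(A + B) ** C = A ** C + B ** C"
  for A B :: "'a::semiring_1^'n^'m"
  by (simp add: matrix_matrix_mult_def vec_eq_iff distrib_right sum.distrib)

lemma matrix_mult_diff_distrib:
  fixes A :: "'a::ring_1^'n^'m"
  shows "A ** (B - C) = A ** B - A ** C"
  by (simp add: matrix_matrix_mult_def vec_eq_iff right_diff_distrib sum_subtractf)

lemma matrix_mult_diff_rdistrib:
  fixes A B :: "'a::ring_1^'n^'m"
  shows "(A - B) ** C = A ** C - B ** C"
  by (simp add: matrix_matrix_mult_def vec_eq_iff left_diff_distrib sum_subtractf)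

lemma matrix_inv_inverse:
  assumes "invertible A"
  shows "A ** matrix_inv A = mat 1" "matrix_inv A ** A = mat 1"
  using someI_ex [OF assms [unfolded invertible_def]] by (simp_all add: matrix_inv_def)

text \<open>The quadratic form is the squared norm of the observability matrix applied to
  \<open>x\<close>.\<close>

lemma pos_semidef_obs_gramian: "pos_semidef (obs_gramian C A N)"
  unfolding pos_semidef_def
proof (intro conjI allI)
  let ?O = "obs_matrix C A" and ?R = "{..<N} \<times> UNIV"
  show "transpose (obs_gramian C A N) = obs_gramian C A N"
    by (simp add: vec_eq_iff transpose_def obs_gramian_eq_inner_columns mult.commute)
  fix x
  have "x \<bullet> (obs_gramian C A N *v x) =
      (\<Sum>i\<in>UNIV. \<Sum>j\<in>UNIV. \<Sum>r\<in>?R. (?O r i * x $ i) * (?O r j * x $ j))"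
    by (simp add: inner_vec_def matrix_vector_mult_def obs_gramian_eq_inner_columns
        sum_distrib_left sum_distrib_right ac_simps)
  also have "\<dots> = (\<Sum>i\<in>UNIV. \<Sum>r\<in>?R. \<Sum>j\<in>UNIV. (?O r i * x $ i) * (?O r j * x $ j))"
    by (intro sum.cong refl sum.swap)
  also have "\<dots> = (\<Sum>r\<in>?R. (\<Sum>i\<in>UNIV. ?O r i * x $ i)\<^sup>2)"
    by (subst sum.swap) (simp add: power2_eq_square sum_product)
  also have "\<dots> \<ge> 0"
    by (simp add: sum_nonneg)
  finally show "0 \<le> x \<bullet> (obs_gramian C A N *v x)" .
qed

text \<open>The determinant is the sum of all principal minors, which are nonnegative, and the empty
  one equals 1.\<close>

lemma det_add_mat_1_pos:
  assumes "pos_semidef L"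
  shows "0 < det (L + mat 1)"
proof -
  have "(\<Sum>T\<in>UNIV. principal_minor L T) = det (L + mat 1)"
    using sum_principal_minors_superset [of L "{}"] by (simp add: vec_lambda_eta del: vector_add_component)
  moreover have "principal_minor L {} \<le> (\<Sum>T\<in>UNIV. principal_minor L T)"
    using principal_minor_nonneg [OF assms] by (intro member_le_sum) auto
  ultimately show ?thesis
    by (simp add: principal_minor_empty)
qed

context
  fixes L :: "real^'n^'n"
  assumes L: "pos_semidef L"
begin

lemma resolvent_inverse:
  "(L + mat 1) ** matrix_inv (L + mat 1) = mat 1"
  "matrix_inv (L + mat 1) ** (L + mat 1) = mat 1"
  using det_add_mat_1_pos [OF L] by (simp_all add: matrix_inv_inverse invertible_det_nz)

lemma transpose_resolvent: "transpose (matrix_inv (L + mat 1)) = matrix_inv (L + mat 1)"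
proof -
  let ?P = "L + mat 1" and ?G = "matrix_inv (L + mat 1)"
  have "transpose ?P = ?P"
    using L by (auto simp: pos_semidef_def vec_eq_iff transpose_def mat_def)
  then have "transpose ?G ** ?P = mat 1"
    by (metis matrix_transpose_mul resolvent_inverse(1) transpose_mat)
  then show ?thesis
    by (metis matrix_mul_assoc matrix_mul_lid matrix_mul_rid resolvent_inverse(1))
qed

lemma resolvent_commute: "matrix_inv (L + mat 1) $ i $ j = matrix_inv (L + mat 1) $ j $ i"
  using arg_cong [OF transpose_resolvent, of "\<lambda>M. M $ j $ i"] by (simp add: transpose_def)

lemma resolvent_apply:
  "x = L *v (matrix_inv (L + mat 1) *v x) + matrix_inv (L + mat 1) *v x"
  by (metis matrix_vector_mul_assoc matrix_vector_mul_lid matrix_vector_mult_add_rdistrib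
      resolvent_inverse(1))

text \<open>With \<open>x = L *v y + y\<close> the form equals
  \<open>y \<bullet> (L *v y) + y \<bullet> y\<close>.\<close>

lemma resolvent_pos:
  assumes "x \<noteq> 0"
  shows "0 < x \<bullet> (matrix_inv (L + mat 1) *v x)"
proof -
  define y where "y = matrix_inv (L + mat 1) *v x"
  have x: "x = L *v y + y"
    unfolding y_def by (rule resolvent_apply)
  then have "y \<noteq> 0"
    using assms by auto
  moreover have "0 \<le> y \<bullet> (L *v y)"
    using L by (simp add: pos_semidef_def)
  ultimately have "0 < y \<bullet> (L *v y) + y \<bullet> y"
    by (simp add: add_nonneg_pos)
  then have "0 < x \<bullet> y"
    by (subst x) (simp add: inner_add_left inner_add_right inner_commute)
  then show ?thesis
    by (simp add: y_def)
qed

lemma resolvent_diag_pos: "0 < matrix_inv (L + mat 1) $ i $ i"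
proof -
  have "axis i (1::real) \<noteq> 0"
    by simp
  from resolvent_pos [OF this] show ?thesis
    by (simp add: inner_axis' matrix_vector_mult_basis column_def)
qed

lemma resolvent_minor_pos:
  assumes "i \<noteq> j"
  shows "(matrix_inv (L + mat 1) $ i $ j)\<^sup>2
    < matrix_inv (L + mat 1) $ i $ i * matrix_inv (L + mat 1) $ j $ j"
proof -
  let ?G = "matrix_inv (L + mat 1)"
  \<comment> \<open>This combination is orthogonal to \<open>axis j 1\<close> with respect to
    \<open>?G\<close>, so its form is \<open>?G $ j $ j\<close> times the 2 by 2 minor.\<close>
  define x where "x = ?G $ j $ j *\<^sub>R axis i 1 - ?G $ i $ j *\<^sub>R axis j (1::real)"
  have "x $ i = ?G $ j $ j"
    using assms by (simp add: x_def axis_def)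
  then have "x \<noteq> 0"
    using resolvent_diag_pos [of j] by auto
  from resolvent_pos [OF this]
  have "0 < ?G $ j $ j * (?G $ i $ i * ?G $ j $ j - (?G $ i $ j)\<^sup>2)"
    using resolvent_commute [of j i]
    by (simp add: x_def matrix_vector_mult_diff_distrib matrix_vector_mult_scaleR
        matrix_vector_mult_basis column_def inner_diff_left inner_diff_right inner_axis'
        power2_eq_square algebra_simps)
  then show ?thesis
    using resolvent_diag_pos [of j] by (simp add: zero_less_mult_iff)
qed

lemma marginal_kernel_eq_resolvent: "marginal_kernel L = mat 1 - matrix_inv (L + mat 1)"
  using resolvent_inverse(1) by (simp add: marginal_kernel_def matrix_mult_add_rdistrib eq_diff_eq)

lemma marginal_kernel_mult: "marginal_kernel L ** (L + mat 1) = L"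
  by (metis marginal_kernel_def matrix_mul_assoc matrix_mul_rid resolvent_inverse(2))

lemma pos_semidef_marginal_kernel: "pos_semidef (marginal_kernel L)"
  unfolding pos_semidef_def
proof (intro conjI allI)
  show "transpose (marginal_kernel L) = marginal_kernel L"
    using resolvent_commute
    by (auto simp: marginal_kernel_eq_resolvent vec_eq_iff transpose_def mat_def)
  fix x
  define y where "y = matrix_inv (L + mat 1) *v x"
  have x: "x = L *v y + y"
    unfolding y_def by (rule resolvent_apply)
  have "x \<bullet> (marginal_kernel L *v x) = (L *v y + y) \<bullet> (L *v y)"
    by (subst (1) x) (simp add: marginal_kernel_def matrix_vector_mul_assoc [symmetric] y_def)
  also have "\<dots> = (L *v y) \<bullet> (L *v y) + y \<bullet> (L *v y)"
    by (simp add: inner_add_left)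
  also have "\<dots> \<ge> 0"
    using L by (simp add: pos_semidef_def)
  finally show "0 \<le> x \<bullet> (marginal_kernel L *v x)" .
qed

lemma measure_L_ensemble_superset:
  "measure (L_ensemble L) {T. S \<subseteq> T} = principal_minor (marginal_kernel L) S"
proof -
  let ?K = "marginal_kernel L" and ?P = "L + mat 1"
  have nonneg: "0 \<le> principal_minor L T / det ?P" for T
    using principal_minor_nonneg [OF L] det_add_mat_1_pos [OF L] by simp
  have "(\<chi> i. if i \<in> S then L $ i else ?P $ i) = fill_rows ?K S ** ?P"
  proof -
    have "(fill_rows ?K S ** ?P) $ i $ j = (if i \<in> S then (?K ** ?P) $ i $ j else ?P $ i $ j)" for i j
      by (simp add: matrix_matrix_mult_def fill_rows_nth mult_delta_left)
    then show ?thesis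
      by (simp add: vec_eq_iff marginal_kernel_mult)
  qed
  then have sum: "(\<Sum>T | S \<subseteq> T. principal_minor L T) = principal_minor ?K S * det ?P"
    by (simp add: sum_principal_minors_superset det_mul det_fill_rows)
  have "emeasure (L_ensemble L) {T. S \<subseteq> T} =
      (\<Sum>T | S \<subseteq> T. ennreal (principal_minor L T / det ?P))"
    unfolding L_ensemble_def by (rule emeasure_point_measure_finite) auto
  also have "\<dots> = ennreal (\<Sum>T | S \<subseteq> T. principal_minor L T / det ?P)"
    using nonneg by (intro sum_ennreal) auto
  finally have "measure (L_ensemble L) {T. S \<subseteq> T} = (\<Sum>T | S \<subseteq> T. principal_minor L T / det ?P)"
    using nonneg by (simp add: measure_def sum_nonneg)
  also have "\<dots> = principal_minor ?K S"
    using sum det_add_mat_1_pos [OF L] by (simp add: sum_divide_distrib [symmetric])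
  finally show ?thesis .
qed

end

section \<open>Perturbing one off-diagonal pair of entries\<close>

lemma matrix_mult_two_entries:
  fixes X D Y :: "'a::comm_ring_1^'n^'n"
  assumes "i \<noteq> j" and D: "\<And>k l. {k, l} \<noteq> {i, j} \<Longrightarrow> D $ k $ l = 0"
  shows "(X ** D ** Y) $ a $ b =
    X $ a $ i * D $ i $ j * Y $ j $ b + X $ a $ j * D $ j $ i * Y $ i $ b"
proof -
  have row: "(D ** Y) $ k $ b = (if k = i then D $ i $ j * Y $ j $ b else 0) +
      (if k = j then D $ j $ i * Y $ i $ b else 0)" for k
  proof -
    have "(D ** Y) $ k $ b = (\<Sum>l\<in>UNIV. D $ k $ l * Y $ l $ b)"
      by (simp add: matrix_matrix_mult_def)
    also have "\<dots> = (\<Sum>l\<in>UNIV. (if l = j then if k = i then D $ i $ j * Y $ j $ b else 0 else 0) +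
      (if l = i then if k = j then D $ j $ i * Y $ i $ b else 0 else 0))"
    proof (rule sum.cong [OF refl])
      fix l
      show "D $ k $ l * Y $ l $ b = (if l = j then if k = i then D $ i $ j * Y $ j $ b else 0 else 0) +
        (if l = i then if k = j then D $ j $ i * Y $ i $ b else 0 else 0)"
        using assms(1) D [of k l] by (cases "k = i"; cases "k = j"; cases "l = i"; cases "l = j")
          (auto simp: doubleton_eq_iff)
    qed
    finally show ?thesis
      by (simp add: sum.distrib)
  qed
  have "(X ** D ** Y) $ a $ b = (\<Sum>k\<in>UNIV. X $ a $ k * (D ** Y) $ k $ b)"
    by (simp add: matrix_mul_assoc [symmetric]) (simp add: matrix_matrix_mult_def)
  then show ?thesis
    by (simp add: row distrib_left sum.distrib mult_delta_right mult.assoc)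
qed

context
  fixes L L' :: "real^'n^'n" and i j :: 'n
  assumes L: "pos_semidef L" and L': "pos_semidef L'" and ij: "i \<noteq> j"
    and same: "\<And>k l. {k, l} \<noteq> {i, j} \<Longrightarrow> L' $ k $ l = L $ k $ l"
begin

text \<open>The resolvent identity, where only the two equal entries of \<open>L' - L\<close> at
  \<open>(i, j)\<close> and \<open>(j, i)\<close> can survive.\<close>

lemma resolvent_diff:
  "matrix_inv (L + mat 1) $ a $ b - matrix_inv (L' + mat 1) $ a $ b =
    (L' $ i $ j - L $ i $ j) *
    (matrix_inv (L' + mat 1) $ a $ i * matrix_inv (L + mat 1) $ j $ b +
     matrix_inv (L' + mat 1) $ a $ j * matrix_inv (L + mat 1) $ i $ b)"
proof -
  let ?G = "matrix_inv (L + mat 1)" and ?G' = "matrix_inv (L' + mat 1)"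
  have sym: "L $ j $ i = L $ i $ j" "L' $ j $ i = L' $ i $ j"
    using L L' by (auto simp: pos_semidef_def transpose_def vec_eq_iff)
  have "?G' ** (L' - L) ** ?G = ?G' ** ((L' + mat 1) - (L + mat 1)) ** ?G"
    by simp
  also have "\<dots> = (?G' ** (L' + mat 1)) ** ?G - ?G' ** ((L + mat 1) ** ?G)"
    by (simp only: matrix_mult_diff_distrib matrix_mult_diff_rdistrib matrix_mul_assoc)
  also have "\<dots> = ?G - ?G'"
    by (simp only: resolvent_inverse [OF L] resolvent_inverse [OF L'] matrix_mul_lid matrix_mul_rid)
  finally have "(?G - ?G') $ a $ b = (?G' ** (L' - L) ** ?G) $ a $ b"
    by simp
  also have "\<dots> = ?G' $ a $ i * (L' - L) $ i $ j * ?G $ j $ b + ?G' $ a $ j * (L' - L) $ j $ i * ?G $ i $ b"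
    using ij same by (intro matrix_mult_two_entries) auto
  finally show ?thesis
    by (simp add: sym algebra_simps)
qed

lemma marginal_kernel_strict_mono_entry:
  assumes "L $ i $ j < L' $ i $ j"
  shows "marginal_kernel L $ i $ j < marginal_kernel L' $ i $ j"
proof -
  define G G' where "G = matrix_inv (L + mat 1)" and "G' = matrix_inv (L' + mat 1)"
  note diff = resolvent_diff [folded G_def G'_def]
  have comm: "G $ j $ i = G $ i $ j" "G' $ j $ i = G' $ i $ j"
    unfolding G_def G'_def by (rule resolvent_commute [OF L] resolvent_commute [OF L'])+
  have pos: "0 < G $ k $ k" "0 < G' $ k $ k" for k
    unfolding G_def G'_def by (rule resolvent_diag_pos [OF L] resolvent_diag_pos [OF L'])+
  define d where "d = L' $ i $ j - L $ i $ j"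
  define c where "c = G' $ i $ i * G $ j $ j"
  have "d > 0"
    using assms by (simp add: d_def)
  \<comment> \<open>Both sides are the same change of the resolvent, read at \<open>(i, j)\<close>
    and at \<open>(j, i)\<close>.\<close>
  have "d * (c + G' $ i $ j * G $ i $ j) = d * (G' $ j $ j * G $ i $ i + G' $ i $ j * G $ i $ j)"
    using diff [of i j] diff [of j i] by (simp add: comm c_def d_def algebra_simps)
  then have c: "c = G' $ j $ j * G $ i $ i"
    using \<open>d > 0\<close> by simp
  \<comment> \<open>The two expressions for \<open>c\<close> turn the product of the minor
    inequalities into a bound by \<open>c\<^sup>2\<close>; so \<open>c\<close> dominates even when
    the off-diagonal entries have opposite signs.\<close>
  have "(G' $ i $ j)\<^sup>2 * (G $ i $ j)\<^sup>2 < (G' $ i $ i * G' $ j $ j) * (G $ i $ i * G $ j $ j)"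
    using resolvent_minor_pos [OF L ij] resolvent_minor_pos [OF L' ij]
    by (intro mult_strict_mono') (simp_all add: G_def G'_def)
  moreover have "c\<^sup>2 = c * (G' $ j $ j * G $ i $ i)"
    unfolding power2_eq_square by (rule arg_cong [OF c])
  ultimately have "\<bar>G' $ i $ j * G $ i $ j\<bar>\<^sup>2 < c\<^sup>2"
    by (simp add: c_def power_mult_distrib ac_simps)
  moreover have "0 \<le> c"
    unfolding c_def by (intro mult_nonneg_nonneg less_imp_le pos)
  ultimately have "\<bar>G' $ i $ j * G $ i $ j\<bar> < c"
    by (rule power2_less_imp_less)
  then have "0 < d * (c + G' $ i $ j * G $ i $ j)"
    using \<open>d > 0\<close> by simp
  then have "G' $ i $ j < G $ i $ j"
    using diff [of i j] by (simp add: c_def d_def)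
  then show ?thesis
    using ij by (simp add: marginal_kernel_eq_resolvent L L' G_def G'_def mat_def)
qed

lemma marginal_kernel_square_strict_mono:
  assumes iso: "\<And>k. k \<notin> {i, j} \<Longrightarrow> L $ i $ k = 0"
    and less: "\<bar>L $ i $ j\<bar> < \<bar>L' $ i $ j\<bar>"
  shows "(marginal_kernel L $ i $ j)\<^sup>2 < (marginal_kernel L' $ i $ j)\<^sup>2"
proof -
  define G G' where "G = matrix_inv (L + mat 1)" and "G' = matrix_inv (L' + mat 1)"
  note diff = resolvent_diff [folded G_def G'_def]
  have comm: "G $ j $ i = G $ i $ j" "G' $ j $ i = G' $ i $ j"
    unfolding G_def G'_def by (rule resolvent_commute [OF L] resolvent_commute [OF L'])+
  have pos: "0 < G $ j $ j" "0 < G' $ j $ j"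
    unfolding G_def G'_def by (rule resolvent_diag_pos [OF L] resolvent_diag_pos [OF L'])+
  define p where "p = L $ i $ i + 1"
  have Lii: "L' $ i $ i = L $ i $ i"
    using ij by (intro same) auto
  have iso': "L' $ i $ k = 0" if "k \<notin> {i, j}" for k
    using iso [OF that] same [of i k] that by (auto simp: doubleton_eq_iff)
  have "0 \<le> axis i 1 \<bullet> (L *v axis i 1)"
    using L by (simp add: pos_semidef_def)
  then have p: "p > 0"
    by (simp add: p_def inner_axis' matrix_vector_mult_basis column_def)
  have row: "(M $ i $ i + 1) * matrix_inv (M + mat 1) $ i $ j + M $ i $ j * matrix_inv (M + mat 1) $ j $ j = 0"
    if M: "pos_semidef M" and M0: "\<And>k. k \<notin> {i, j} \<Longrightarrow> M $ i $ k = 0" for M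
  proof -
    have "0 = ((M + mat 1) ** matrix_inv (M + mat 1)) $ i $ j"
      unfolding resolvent_inverse(1) [OF M] using ij by (simp add: mat_def)
    also have "\<dots> = (\<Sum>k\<in>UNIV. (M + mat 1) $ i $ k * matrix_inv (M + mat 1) $ k $ j)"
      by (simp add: matrix_matrix_mult_def)
    also have "\<dots> = (\<Sum>k\<in>{i, j}. (M + mat 1) $ i $ k * matrix_inv (M + mat 1) $ k $ j)"
      using M0 by (intro sum.mono_neutral_right) (auto simp: mat_def)
    finally show ?thesis
      using ij by (simp add: mat_def)
  qed
  have Gij: "p * G $ i $ j = - (L $ i $ j * G $ j $ j)"
    using row [OF L iso] by (simp add: p_def G_def)
  have G'ij: "p * G' $ i $ j = - (L' $ i $ j * G' $ j $ j)"
    using row [OF L' iso'] by (simp add: p_def G'_def Lii)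
  have diff_jj: "G' $ j $ j - G $ j $ j =
      - (L' $ i $ j - L $ i $ j) * (G' $ i $ j * G $ j $ j + G' $ j $ j * G $ i $ j)"
    using diff [of j j] by (simp add: comm algebra_simps)
  \<comment> \<open>Multiplying by \<open>p\<close> allows the off-diagonal entries to be eliminated
    through \<open>Gij\<close> and \<open>G'ij\<close>. A difference of squares remains, so only
    absolute values of the couplings matter and a change of sign is allowed.\<close>
  have "p * (G' $ j $ j - G $ j $ j) =
      - (L' $ i $ j - L $ i $ j) * ((p * G' $ i $ j) * G $ j $ j + G' $ j $ j * (p * G $ i $ j))"
    unfolding diff_jj by (simp add: algebra_simps)
  also have "\<dots> = ((L' $ i $ j)\<^sup>2 - (L $ i $ j)\<^sup>2) * (G $ j $ j * G' $ j $ j)"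
    unfolding Gij G'ij by (simp add: power2_eq_square algebra_simps)
  also have "\<dots> > 0"
    using power_strict_mono [OF less, of 2] pos by simp
  finally have "G $ j $ j < G' $ j $ j"
    using p by (simp add: zero_less_mult_iff)
  then have "\<bar>L $ i $ j\<bar> * G $ j $ j < \<bar>L' $ i $ j\<bar> * G' $ j $ j"
    using less pos by (intro mult_strict_mono') auto
  then have "\<bar>p * G $ i $ j\<bar> < \<bar>p * G' $ i $ j\<bar>"
    unfolding Gij G'ij using pos by (simp add: abs_mult)
  then have "\<bar>G $ i $ j\<bar> < \<bar>G' $ i $ j\<bar>"
    using p by (simp add: abs_mult)
  then have "(G $ i $ j)\<^sup>2 < (G' $ i $ j)\<^sup>2"
    by (metis abs_ge_zero power2_abs power_strict_mono zero_less_numeral)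
  then show ?thesis
    using ij by (simp add: marginal_kernel_eq_resolvent L L' G_def G'_def mat_def)
qed

end

text \<open>Correlation is read as the Gramian entry \<open>L $ i $ j\<close>, and Gramians are
  compared that agree in all entries except \<open>(i, j)\<close> and \<open>(j, i)\<close>.
  Coupling through other nodes can make \<open>K $ i $ j\<close> nonzero even when
  \<open>L $ i $ j = 0\<close>, so in general the gap is shown to grow when the entry moves
  \<open>K $ i $ j\<close> away from zero; growth in the absolute value of the entry is stated when
  node \<open>i\<close> is coupled to \<open>j\<close> only.\<close>

theorem corollary4:
  fixes A :: "real^'n^'n" and N :: nat
    and M :: "'w measure" and Y :: "'w \<Rightarrow> 'n set"
  defines "L \<equiv> obs_gramian (mat 1 :: real^'n^'n) A N"
  defines "K \<equiv> marginal_kernel L"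
  assumes N: "N \<ge> 1"
    and M: "prob_space M"
    and Y: "Y \<in> measurable M (count_space UNIV)"
    and Y_distr: "distr M (count_space UNIV) Y = L_ensemble L"
  shows "(\<forall>S1 S2. S1 \<inter> S2 = {} \<longrightarrow>
            \<P>(\<omega> in M. S1 \<union> S2 \<subseteq> Y \<omega>)
              \<le> \<P>(\<omega> in M. S1 \<subseteq> Y \<omega>) * \<P>(\<omega> in M. S2 \<subseteq> Y \<omega>)) \<and>
         (\<forall>i j. i \<noteq> j \<longrightarrow>
            \<P>(\<omega> in M. i \<in> Y \<omega> \<and> j \<in> Y \<omega>) = K $ i $ i * K $ j $ j - (K $ i $ j)\<^sup>2 \<and>
            K $ i $ i * K $ j $ j - (K $ i $ j)\<^sup>2
              \<le> \<P>(\<omega> in M. i \<in> Y \<omega>) * \<P>(\<omega> in M. j \<in> Y \<omega>) \<and>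
            \<P>(\<omega> in M. i \<in> Y \<omega>) * \<P>(\<omega> in M. j \<in> Y \<omega>)
              - \<P>(\<omega> in M. i \<in> Y \<omega> \<and> j \<in> Y \<omega>) = (K $ i $ j)\<^sup>2 \<and>
            (\<forall>A' N' L' K'.
               N' \<ge> 1 \<and> L' = obs_gramian (mat 1) A' N' \<and> K' = marginal_kernel L' \<and>
               (\<forall>k l. {k, l} \<noteq> {i, j} \<longrightarrow> L' $ k $ l = L $ k $ l) \<longrightarrow>
                 (L $ i $ j < L' $ i $ j \<longrightarrow> K $ i $ j < K' $ i $ j) \<and>
                 (0 \<le> K $ i $ j \<and> L $ i $ j < L' $ i $ j \<longrightarrow> (K $ i $ j)\<^sup>2 < (K' $ i $ j)\<^sup>2) \<and>
                 (K $ i $ j \<le> 0 \<and> L' $ i $ j < L $ i $ j \<longrightarrow> (K $ i $ j)\<^sup>2 < (K' $ i $ j)\<^sup>2) \<and>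
                 ((\<forall>k. k \<notin> {i, j} \<longrightarrow> L $ i $ k = 0) \<and> \<bar>L $ i $ j\<bar> < \<bar>L' $ i $ j\<bar>
                    \<longrightarrow> (K $ i $ j)\<^sup>2 < (K' $ i $ j)\<^sup>2)))"
proof (intro conjI allI impI)
  have L: "pos_semidef L"
    unfolding L_def by (rule pos_semidef_obs_gramian)
  note K = pos_semidef_marginal_kernel [OF L, folded K_def]
  have K_comm: "K $ l $ k = K $ k $ l" for k l
    using K by (auto simp: pos_semidef_def transpose_def vec_eq_iff)
  have incl: "\<P>(\<omega> in M. S \<subseteq> Y \<omega>) = principal_minor K S" for S
  proof -
    have "measure (distr M (count_space UNIV) Y) {T. S \<subseteq> T} = \<P>(\<omega> in M. S \<subseteq> Y \<omega>)"
      using Y by (subst measure_distr) (auto intro!: arg_cong [where f = "measure M"])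
    then show ?thesis
      by (simp add: Y_distr measure_L_ensemble_superset L K_def)
  qed
  have single: "\<P>(\<omega> in M. k \<in> Y \<omega>) = K $ k $ k" for k
    using incl [of "{k}"] by (simp add: principal_minor_singleton)
  have pair: "\<P>(\<omega> in M. k \<in> Y \<omega> \<and> l \<in> Y \<omega>) = K $ k $ k * K $ l $ l - (K $ k $ l)\<^sup>2"
    if "k \<noteq> l" for k l
    using incl [of "{k, l}"] that
    by (simp add: principal_minor_doubleton K_comm [of l k] power2_eq_square)
  show "\<P>(\<omega> in M. S1 \<union> S2 \<subseteq> Y \<omega>) \<le> \<P>(\<omega> in M. S1 \<subseteq> Y \<omega>) * \<P>(\<omega> in M. S2 \<subseteq> Y \<omega>)"
    if "S1 \<inter> S2 = {}" for S1 S2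
    unfolding incl using K that by (rule Fischer_inequality)
  fix i j :: 'n assume ij: "i \<noteq> j"
  show "\<P>(\<omega> in M. i \<in> Y \<omega> \<and> j \<in> Y \<omega>) = K $ i $ i * K $ j $ j - (K $ i $ j)\<^sup>2"
    using ij by (rule pair)
  show "K $ i $ i * K $ j $ j - (K $ i $ j)\<^sup>2 \<le> \<P>(\<omega> in M. i \<in> Y \<omega>) * \<P>(\<omega> in M. j \<in> Y \<omega>)"
    by (simp add: single)
  show "\<P>(\<omega> in M. i \<in> Y \<omega>) * \<P>(\<omega> in M. j \<in> Y \<omega>)
      - \<P>(\<omega> in M. i \<in> Y \<omega> \<and> j \<in> Y \<omega>) = (K $ i $ j)\<^sup>2"
    using ij by (simp add: single pair)
  fix A' :: "real^'n^'n" and N' :: nat and L' K' :: "real^'n^'n"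
  assume asm: "N' \<ge> 1 \<and> L' = obs_gramian (mat 1) A' N' \<and> K' = marginal_kernel L' \<and>
    (\<forall>k l. {k, l} \<noteq> {i, j} \<longrightarrow> L' $ k $ l = L $ k $ l)"
  have L': "pos_semidef L'" and K': "K' = marginal_kernel L'"
    using asm by (auto simp: pos_semidef_obs_gramian)
  have same: "L' $ k $ l = L $ k $ l" if "{k, l} \<noteq> {i, j}" for k l
    using asm that by blast
  have up: "K $ i $ j < K' $ i $ j" if "L $ i $ j < L' $ i $ j"
    unfolding K_def K' using L L' ij same that by (rule marginal_kernel_strict_mono_entry)
  \<comment> \<open>The same monotonicity with the roles of \<open>L\<close> and \<open>L'\<close>
    exchanged.\<close>
  have down: "K' $ i $ j < K $ i $ j" if "L' $ i $ j < L $ i $ j"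
    unfolding K_def K' using L' L ij same [symmetric] that by (rule marginal_kernel_strict_mono_entry)
  show "K $ i $ j < K' $ i $ j" if "L $ i $ j < L' $ i $ j"
    using that by (rule up)
  show "(K $ i $ j)\<^sup>2 < (K' $ i $ j)\<^sup>2" if "0 \<le> K $ i $ j \<and> L $ i $ j < L' $ i $ j"
    using up that by (intro power_strict_mono) auto
  show "(K $ i $ j)\<^sup>2 < (K' $ i $ j)\<^sup>2" if "K $ i $ j \<le> 0 \<and> L' $ i $ j < L $ i $ j"
    using down that power_strict_mono [of "- K $ i $ j" "- K' $ i $ j" 2] by auto
  show "(K $ i $ j)\<^sup>2 < (K' $ i $ j)\<^sup>2"
    if "(\<forall>k. k \<notin> {i, j} \<longrightarrow> L $ i $ k = 0) \<and> \<bar>L $ i $ j\<bar> < \<bar>L' $ i $ j\<bar>"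
    unfolding K_def K' using L L' ij same that
    by (intro marginal_kernel_square_strict_mono) auto
qed

end
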